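(* There exists a deterministic online parallel-work-oblivious scheduler for the serial-parallel scheduling problem that is $6$-competitive for awake time: for every task arrival process $\mathcal{T}$, its awake time on $\mathcal{T}$ is at most $6$ times the awake time of the optimal offline schedule $\texttt{OPT}$ on $\mathcal{T}$.
   Context: Serial-parallel scheduling problem: there are $p$ identical processors ($p$ at least a sufficiently large constant). A task arrival process (TAP) is a finite set of tasks $\tau_1,\dots,\tau_n$; task $\tau_i$ is a triple $(\sigma_i,\pi_i,t_i)$ with arrival time $t_i\ge 0$, serial work $\sigma_i$ and parallel work $\pi_i$, where $1\le \pi_i/\sigma_i\le p$. Each task can be performed either by its serial job (work $\sigma_i$, at most one processor at any instant) or by its parallel job (work $\pi_i$, any number of processors simultaneously, progressing at a rate equal to the number of processors). Time is continuous; at each instant the scheduler allocates the $p$ processors (fractionally, via time sharing) among arrived, unfinished jobs; a job completes when the integral over time of the processors allocated to it reaches its work. Before any work is done on a task the scheduler must irrevocably choose which job to run; preemption is allowed. A task is alive from arrival until completion; the awake time of a schedule is the measure of the set of times at which at least one task is alive. An online scheduler learns about a task only when it arrives; $\texttt{OPT}$ is an optimal offline schedule. A parallel-work-oblivious scheduler learns, upon arrival of $\tau_i$, the values $t_i$ and $\sigma_i$ but never the parallel work $\pi_i$ (it only observes when a running parallel job completes). *)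

theory Defs
  imports "HOL-Analysis.Analysis"
begin

type_synonym task = "real \<times> real \<times> real"

definition ser :: "task \<Rightarrow> real" where "ser \<tau> = fst \<tau>"
definition par :: "task \<Rightarrow> real" where "par \<tau> = fst (snd \<tau>)"
definition arr :: "task \<Rightarrow> real" where "arr \<tau> = snd (snd \<tau>)"

text \<open>A task arrival process (TAP) on p processors: a finite list of tasks,
  listed in order of nondecreasing arrival time (so that the index of a task
  reveals nothing about the future), with arrival times at least 0, positive
  serial work and 1 <= pi/sigma <= p.\<close>
definition wf_tap :: "nat \<Rightarrow> task list \<Rightarrow> bool" where
  "wf_tap p T \<longleftrightarrow>
     (\<forall>\<tau>\<in>set T. 0 \<le> arr \<tau> \<and> 0 < ser \<tau> \<and> ser \<tau> \<le> par \<tau> \<and> par \<tau> \<le> real p * ser \<tau>)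
     \<and> sorted (map arr T)"

text \<open>A schedule: for every task index i a choice (True = parallel job,
  False = serial job) and an allocation function: number of processors
  (fractional) given to task i at time t.\<close>
type_synonym schedule = "(nat \<Rightarrow> bool) \<times> (nat \<Rightarrow> real \<Rightarrow> real)"

definition work :: "task list \<Rightarrow> schedule \<Rightarrow> nat \<Rightarrow> real" where
  "work T X i = (if fst X i then par (T ! i) else ser (T ! i))"

definition done_work :: "schedule \<Rightarrow> nat \<Rightarrow> real \<Rightarrow> real" where
  "done_work X i t = integral {0..t} (snd X i)"

definition comp :: "task list \<Rightarrow> schedule \<Rightarrow> nat \<Rightarrow> real" where
  "comp T X i = Inf {t. work T X i \<le> done_work X i t}"

definition start :: "schedule \<Rightarrow> nat \<Rightarrow> real" where
  "start X i = Inf {t. 0 < done_work X i t}"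

definition valid :: "nat \<Rightarrow> task list \<Rightarrow> schedule \<Rightarrow> bool" where
  "valid p T X \<longleftrightarrow>
     (\<forall>i t. 0 \<le> snd X i t)
   \<and> (\<forall>i t. snd X i t \<noteq> 0 \<longrightarrow> i < length T \<and> arr (T ! i) \<le> t \<and> t < comp T X i)
   \<and> (\<forall>t. (\<Sum>i<length T. snd X i t) \<le> real p)
   \<and> (\<forall>i t. \<not> fst X i \<longrightarrow> snd X i t \<le> 1)
   \<and> (\<forall>i t. snd X i integrable_on {0..t})
   \<and> (\<forall>i<length T. \<exists>t. work T X i \<le> done_work X i t)"

definition awake :: "task list \<Rightarrow> schedule \<Rightarrow> real" where
  "awake T X = measure lborel (\<Union>i<length T. {arr (T ! i) ..< comp T X i})"

text \<open>A (deterministic) scheduler maps each TAP to a schedule.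
  The information available to an online parallel-work-oblivious scheduler
  strictly before time t: which tasks have arrived, their arrival times and
  serial works, and which parallel jobs have completed and when.\<close>
definition same_info ::
  "(task list \<Rightarrow> schedule) \<Rightarrow> task list \<Rightarrow> task list \<Rightarrow> real \<Rightarrow> bool" where
  "same_info S T T' t \<longleftrightarrow>
     (\<forall>i. (i < length T \<and> arr (T ! i) < t) \<longleftrightarrow> (i < length T' \<and> arr (T' ! i) < t))
   \<and> (\<forall>i. i < length T \<and> arr (T ! i) < t \<longrightarrow>
          arr (T ! i) = arr (T' ! i) \<and> ser (T ! i) = ser (T' ! i))
   \<and> (\<forall>i. i < length T \<and> fst (S T) i \<and> comp T (S T) i < t \<longrightarrow>
          i < length T' \<and> fst (S T') i \<and> comp T' (S T') i = comp T (S T) i)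
   \<and> (\<forall>i. i < length T' \<and> fst (S T') i \<and> comp T' (S T') i < t \<longrightarrow>
          i < length T \<and> fst (S T) i \<and> comp T (S T) i = comp T' (S T') i)"

definition online_oblivious :: "nat \<Rightarrow> (task list \<Rightarrow> schedule) \<Rightarrow> bool" where
  "online_oblivious p S \<longleftrightarrow>
     (\<forall>T T' t. wf_tap p T \<longrightarrow> wf_tap p T' \<longrightarrow> same_info S T T' t \<longrightarrow>
        (\<forall>i. \<forall>s<t. snd (S T) i s = snd (S T') i s)
      \<and> (\<forall>i. i < length T \<and> start (S T) i < t \<longrightarrow> fst (S T) i = fst (S T') i))"

end

theory Submission
  imports Defs
begin

text \<open>The scheduler works in batches: whenever it is idle, it takes all pending tasks as the next
  batch. Within a batch it runs the parallel jobs, by decreasing serial work and each on all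
  processors, as long as the time spent on the batch is below the serial work of the next task. The
  remaining tasks are run serially at rates proportional to their works, so that they all finish
  after \<open>max (max \<sigma>) (\<Sum>\<sigma> / p)\<close>.

  Let \<open>M\<close> be the time for which a competing schedule has tasks of the batch alive. Tasks with
  \<open>\<sigma> > M\<close> are run in parallel by the competitor, so their parallel works sum to at most \<open>p M\<close>. Hence
  the parallel phase has spent at most \<open>M\<close> before its last task if that has \<open>\<sigma> \<le> M\<close>, which then
  takes at most \<open>\<sigma> \<le> M\<close>, and at most \<open>M\<close> altogether otherwise; and the tasks left over have
  \<open>\<sigma> \<le> M\<close>, so the serial phase takes at most \<open>M\<close>. Thus a batch takes at most \<open>3 M\<close>.

  Tasks of batch \<open>k\<close> arrive after the start of batch \<open>k - 1\<close>. Either the competitor finishes them before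
  batch \<open>k + 1\<close> starts, or it is awake during all of batch \<open>k\<close>. So the competitor is awake for a third
  of the length of batch \<open>k\<close> between the starts of batches \<open>k - 1\<close> and \<open>k + 1\<close>. These windows cover
  each instant at most twice, which gives the factor 6.\<close>

section \<open>A single batch: order, two phases and length\<close>

text \<open>Since offsets grow and serial works shrink along the order, membership of a task in the
  parallel phase can be decided from the offset it would have if all its predecessors were run in
  parallel; this makes the simulation within a batch non-recursive.\<close>

definition precedes :: "(nat \<Rightarrow> real) \<Rightarrow> nat \<Rightarrow> nat \<Rightarrow> bool" where
  "precedes \<sigma> j i \<longleftrightarrow> \<sigma> i < \<sigma> j \<or> \<sigma> i = \<sigma> j \<and> j < i"

definition offset :: "real \<Rightarrow> (nat \<Rightarrow> real) \<Rightarrow> (nat \<Rightarrow> real) \<Rightarrow> nat set \<Rightarrow> nat \<Rightarrow> real" where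
  "offset p \<sigma> \<pi> B i = (\<Sum>j\<in>{j\<in>B. precedes \<sigma> j i}. \<pi> j / p)"

definition par_set :: "real \<Rightarrow> (nat \<Rightarrow> real) \<Rightarrow> (nat \<Rightarrow> real) \<Rightarrow> nat set \<Rightarrow> nat set" where
  "par_set p \<sigma> \<pi> B = {i\<in>B. offset p \<sigma> \<pi> B i < \<sigma> i}"

definition par_len :: "real \<Rightarrow> (nat \<Rightarrow> real) \<Rightarrow> (nat \<Rightarrow> real) \<Rightarrow> nat set \<Rightarrow> real" where
  "par_len p \<sigma> \<pi> B = (\<Sum>j\<in>par_set p \<sigma> \<pi> B. \<pi> j / p)"

text \<open>The inserted term keeps the set nonempty, so that an empty serial phase has length
  0.\<close>

definition ser_len :: "real \<Rightarrow> (nat \<Rightarrow> real) \<Rightarrow> nat set \<Rightarrow> real" where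
  "ser_len p \<sigma> R = Max (insert ((\<Sum>i\<in>R. \<sigma> i) / p) (\<sigma> ` R))"

definition batch_len :: "real \<Rightarrow> (nat \<Rightarrow> real) \<Rightarrow> (nat \<Rightarrow> real) \<Rightarrow> nat set \<Rightarrow> real" where
  "batch_len p \<sigma> \<pi> B = par_len p \<sigma> \<pi> B + ser_len p \<sigma> (B - par_set p \<sigma> \<pi> B)"

lemma precedes_trans: "precedes \<sigma> i j \<Longrightarrow> precedes \<sigma> j k \<Longrightarrow> precedes \<sigma> i k"
  by (auto simp: precedes_def)

lemma precedes_irrefl [simp]: "\<not> precedes \<sigma> i i"
  by (auto simp: precedes_def)

lemma precedes_total: "i \<noteq> j \<Longrightarrow> precedes \<sigma> i j \<or> precedes \<sigma> j i"
  by (auto simp: precedes_def)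

lemma precedes_imp_ge: "precedes \<sigma> j i \<Longrightarrow> \<sigma> i \<le> \<sigma> j"
  by (auto simp: precedes_def)

lemma ex_first:
  assumes "finite A" "A \<noteq> {}"
  obtains r where "r \<in> A" "\<And>i. i \<in> A \<Longrightarrow> \<not> precedes \<sigma> i r"
  using Finite_Set.bex_min_element[OF assms(1) _ _ assms(2), of "precedes \<sigma>"] precedes_irrefl
  by (metis asymp_onI precedes_trans transp_onI)

lemma ex_last:
  assumes "finite A" "A \<noteq> {}"
  obtains r where "r \<in> A" "\<And>i. i \<in> A \<Longrightarrow> \<not> precedes \<sigma> r i"
  using Finite_Set.bex_max_element[OF assms(1) _ _ assms(2), of "precedes \<sigma>"] precedes_irrefl
  by (metis asymp_onI precedes_trans transp_onI)

locale batch =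
  fixes p :: real and \<sigma> \<pi> :: "nat \<Rightarrow> real" and B :: "nat set"
  assumes p_pos: "0 < p" and fin: "finite B"
    and \<sigma>_pos: "\<And>i. i \<in> B \<Longrightarrow> 0 < \<sigma> i"
    and \<sigma>_le: "\<And>i. i \<in> B \<Longrightarrow> \<sigma> i \<le> \<pi> i"
    and \<pi>_le: "\<And>i. i \<in> B \<Longrightarrow> \<pi> i \<le> p * \<sigma> i"
begin

abbreviation "P \<equiv> par_set p \<sigma> \<pi> B"
abbreviation "R \<equiv> B - par_set p \<sigma> \<pi> B"
abbreviation "off \<equiv> offset p \<sigma> \<pi> B"
abbreviation "plen \<equiv> par_len p \<sigma> \<pi> B"
abbreviation "slen \<equiv> ser_len p \<sigma> (B - par_set p \<sigma> \<pi> B)"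

lemma P_sub: "P \<subseteq> B"
  by (auto simp: par_set_def)

lemma \<pi>_pos: "i \<in> B \<Longrightarrow> 0 < \<pi> i"
  using \<sigma>_pos \<sigma>_le by force

lemma fin_P: "finite P" and fin_R: "finite R"
  using fin P_sub finite_subset by auto

lemma off_nonneg: "0 \<le> off i"
  unfolding offset_def using \<pi>_pos p_pos by (intro sum_nonneg) (auto simp: less_imp_le)

lemma plen_nonneg: "0 \<le> plen"
  unfolding par_len_def using \<pi>_pos p_pos P_sub by (intro sum_nonneg) (auto simp: less_imp_le)

lemma slen_ge: "(\<Sum>i\<in>R. \<sigma> i) / p \<le> slen" "i \<in> R \<Longrightarrow> \<sigma> i \<le> slen"
  unfolding ser_len_def using fin_R by (auto intro!: Max_ge)

lemma slen_nonneg: "0 \<le> slen"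
proof -
  have "0 \<le> (\<Sum>i\<in>R. \<sigma> i)" using \<sigma>_pos by (intro sum_nonneg) (auto simp: less_imp_le)
  then show ?thesis using slen_ge(1) p_pos by (meson divide_nonneg_pos order_trans)
qed

lemma slen_pos: "i \<in> R \<Longrightarrow> 0 < slen"
  using slen_ge(2) \<sigma>_pos by fastforce

text \<open>The predecessors of \<open>j\<close> and \<open>j\<close> itself all precede
  \<open>i\<close>. Thus the parallel jobs occupy disjoint time intervals.\<close>

lemma off_step:
  assumes "j \<in> B" "precedes \<sigma> j i"
  shows "off j + \<pi> j / p \<le> off i"
proof -
  have "off j + \<pi> j / p = (\<Sum>x\<in>insert j {x\<in>B. precedes \<sigma> x j}. \<pi> x / p)"
    using fin by (simp add: offset_def)
  also have "\<dots> \<le> off i"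
    unfolding offset_def using fin assms precedes_trans \<pi>_pos p_pos
    by (intro sum_mono2) (auto simp: less_imp_le)
  finally show ?thesis .
qed

text \<open>Backwards along the order, offsets do not grow and serial works do not shrink, so the
  test stays true. Hence all predecessors of a task of \<open>P\<close> run in parallel, and its
  offset is its actual starting time within the batch.\<close>

lemma P_down: 
  assumes "i \<in> P" "j \<in> B" "precedes \<sigma> j i"
  shows "j \<in> P"
proof -
  have "off j \<le> off i" using off_step[OF assms(2,3)] \<pi>_pos[OF assms(2)] p_pos
    by (smt (verit) divide_pos_pos)
  then show ?thesis using assms precedes_imp_ge[OF assms(3)] by (auto simp: par_set_def)
qed

lemma P_off_le:
  assumes "i \<in> P"
  shows "off i + \<pi> i / p \<le> plen"
proof -
  have "off i + \<pi> i / p = (\<Sum>x\<in>insert i {x\<in>B. precedes \<sigma> x i}. \<pi> x / p)"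
    using fin by (simp add: offset_def)
  also have "\<dots> \<le> plen"
    unfolding par_len_def using fin_P assms P_down \<pi>_pos p_pos P_sub
    by (intro sum_mono2) (auto simp: less_imp_le)
  finally show ?thesis .
qed

text \<open>The task \<open>r\<close> of \<open>R\<close> that comes first in the order has the
  largest serial work in \<open>R\<close>. It failed the test, and all its predecessors lie in
  \<open>P\<close>.\<close>

lemma R_le_plen:
  assumes "i \<in> R"
  shows "\<sigma> i \<le> plen"
proof -
  obtain r where r: "r \<in> R" "\<And>j. j \<in> R \<Longrightarrow> \<not> precedes \<sigma> j r"
    using ex_first[of R \<sigma>] fin_R assms by blast
  have "\<sigma> i \<le> \<sigma> r"
    using r assms precedes_total[of i r] precedes_imp_ge by blast
  also have "\<dots> \<le> off r" using r by (auto simp: par_set_def)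
  also have "\<dots> \<le> plen"
    unfolding offset_def par_len_def using r fin_P \<pi>_pos p_pos P_sub
    by (intro sum_mono2) (auto simp: less_imp_le)
  finally show ?thesis .
qed

text \<open>Here \<open>c\<close> is the competitor's choice of jobs and \<open>M\<close> its alive
  time. Only two consequences of feasibility are kept: a serial job takes at least its work, and the
  total work is at most \<open>p * M\<close>.\<close>

lemma batch_len_bound:
  fixes c :: "nat \<Rightarrow> bool" and M :: real
  assumes ser: "\<And>i. i \<in> B \<Longrightarrow> \<not> c i \<Longrightarrow> \<sigma> i \<le> M"
    and tot: "(\<Sum>i\<in>B. if c i then \<pi> i else \<sigma> i) \<le> p * M"
    and M: "0 \<le> M"
  shows "batch_len p \<sigma> \<pi> B \<le> 3 * M"
proof -
  define F where "F = {i\<in>B. M < \<sigma> i}"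
  have F_par: "c i" if "i \<in> F" for i
    using that ser by (force simp: F_def)
  have "(\<Sum>i\<in>F. \<pi> i) = (\<Sum>i\<in>F. if c i then \<pi> i else \<sigma> i)"
    using F_par by (intro sum.cong) auto
  also have "\<dots> \<le> (\<Sum>i\<in>B. if c i then \<pi> i else \<sigma> i)"
    using fin \<pi>_pos \<sigma>_pos by (intro sum_mono2) (auto simp: F_def less_imp_le)
  finally have "(\<Sum>i\<in>F. \<pi> i) \<le> p * M" using tot by linarith
  then have F: "(\<Sum>i\<in>F. \<pi> i / p) \<le> M"
    using p_pos by (simp add: sum_divide_distrib[symmetric] divide_le_eq mult.commute)
  have fin_F: "finite F" using fin by (simp add: F_def)
  have F_mono: "(\<Sum>i\<in>A. \<pi> i / p) \<le> M" if "A \<subseteq> F" for A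
  proof -
    have "(\<Sum>i\<in>A. \<pi> i / p) \<le> (\<Sum>i\<in>F. \<pi> i / p)"
      using that fin_F \<pi>_pos p_pos by (intro sum_mono2) (auto simp: F_def less_imp_le)
    then show ?thesis using F by linarith
  qed
  have plen: "plen \<le> 2 * M"
  proof (cases "P = {}")
    case True
    then show ?thesis using M by (simp add: par_len_def)
  next
    case False
    then obtain l where l: "l \<in> P" "\<And>j. j \<in> P \<Longrightarrow> \<not> precedes \<sigma> l j"
      using ex_last[of P \<sigma>] fin_P by blast
    have pre: "precedes \<sigma> j l" if "j \<in> P" "j \<noteq> l" for j
      using that l precedes_total by blast
    have P_eq: "P = insert l {j\<in>B. precedes \<sigma> j l}"
      using pre l P_down P_sub by blast
    have plen_eq: "plen = \<pi> l / p + off l"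
      unfolding par_len_def by (subst P_eq) (use fin in \<open>simp add: offset_def\<close>)
    show ?thesis
    proof (cases "M < \<sigma> l")
      case True
      \<comment> \<open>The last task \<open>l\<close> has the smallest serial work in
        \<open>P\<close>.\<close>
      then have "P \<subseteq> F"
        unfolding F_def using pre precedes_imp_ge P_sub by force
      then show ?thesis using F_mono[of P] M by (simp add: par_len_def)
    next
      case False
      \<comment> \<open>The job starts before \<open>\<sigma> l\<close>, and
        \<open>\<pi> l \<le> p * \<sigma> l\<close> lets it run for at most
        \<open>\<sigma> l\<close>.\<close>
      have "off l < \<sigma> l" "l \<in> B" using l by (auto simp: par_set_def)
      moreover have "\<pi> l / p \<le> \<sigma> l"
        using \<pi>_le[OF \<open>l \<in> B\<close>] p_pos by (simp add: divide_le_eq mult.commute)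
      ultimately show ?thesis using False plen_eq by linarith
    qed
  qed
  have "\<sigma> i \<le> M" if i: "i \<in> R" for i
  proof (rule ccontr)
    assume "\<not> \<sigma> i \<le> M"
    \<comment> \<open>The predecessors have serial works at least as large, so they exceed
      \<open>M\<close> too. Then \<open>i\<close> would have an offset below \<open>M\<close>, pass
      the test and belong to \<open>P\<close>.\<close>
    then have "insert i {j\<in>B. precedes \<sigma> j i} \<subseteq> F"
      using i precedes_imp_ge by (force simp: F_def)
    from F_mono[OF this] have "\<pi> i / p + off i \<le> M"
      using fin by (simp add: offset_def)
    moreover have "\<sigma> i \<le> off i" using i by (auto simp: par_set_def)
    moreover have "0 < \<pi> i / p" using i \<pi>_pos p_pos by simp
    ultimately show False using \<open>\<not> \<sigma> i \<le> M\<close> by linarith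
  qed
  moreover have "(\<Sum>i\<in>R. \<sigma> i) / p \<le> M"
  proof -
    have "(\<Sum>i\<in>R. \<sigma> i) \<le> (\<Sum>i\<in>B. \<sigma> i)"
      using fin \<sigma>_pos by (intro sum_mono2) (auto simp: less_imp_le)
    also have "\<dots> \<le> (\<Sum>i\<in>B. if c i then \<pi> i else \<sigma> i)"
      using \<sigma>_le by (intro sum_mono) auto
    finally show ?thesis using tot p_pos by (simp add: divide_le_eq mult.commute)
  qed
  ultimately have "slen \<le> M"
    unfolding ser_len_def using fin_R by (subst Max_le_iff) auto
  with plen show ?thesis by (simp add: batch_len_def)
qed

end

section \<open>Two runs of a batch with the same observations\<close>

text \<open>Two runs of a batch with the same serial works but possibly different parallel works. What
  an observer sees up to time \<open>t\<close> after the batch start are the completions \<open>off j + \<pi> j / p < t\<close>.\<close>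

locale two_runs = run: batch p \<sigma> \<pi> B + run': batch p \<sigma>' \<pi>' B
  for p :: real and \<sigma> \<sigma>' \<pi> \<pi>' :: "nat \<Rightarrow> real" and B :: "nat set" +
  fixes t :: real
  assumes same_ser: "\<And>j. j \<in> B \<Longrightarrow> \<sigma>' j = \<sigma> j"
    and agree: "\<And>j. j \<in> run.P \<Longrightarrow> run.off j + \<pi> j / p < t \<Longrightarrow>
      j \<in> run'.P \<and> run'.off j + \<pi>' j / p = run.off j + \<pi> j / p"
begin

lemma same_precedes: "i \<in> B \<Longrightarrow> j \<in> B \<Longrightarrow> precedes \<sigma>' j i \<longleftrightarrow> precedes \<sigma> j i"
  by (simp add: precedes_def same_ser)

text \<open>By induction on the number of predecessors: each of them completes by
  \<open>off i\<close>, hence before \<open>t\<close>, so its completion is the same in both runs.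
  Equal offsets and equal completions give equal durations.\<close>

lemma same_offset:
  assumes "i \<in> run.P" "run.off i < t"
  shows "run'.off i = run.off i \<and> i \<in> run'.P"
  using assms
proof (induction "card {j\<in>B. precedes \<sigma> j i}" arbitrary: i rule: less_induct)
  case less
  have iB: "i \<in> B" using less.prems run.P_sub by blast
  have "\<pi>' j / p = \<pi> j / p" if j: "j \<in> B" "precedes \<sigma> j i" for j
  proof -
    have "j \<in> run.P" using run.P_down less.prems j by blast
    moreover have lt: "run.off j + \<pi> j / p < t"
      using run.off_step[OF j] less.prems by linarith
    moreover have "run.off j < t"
      using lt run.\<pi>_pos[OF j(1)] run.p_pos by (smt (verit) divide_pos_pos)
    moreover have "card {x\<in>B. precedes \<sigma> x j} < card {x\<in>B. precedes \<sigma> x i}"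
    proof (rule psubset_card_mono)
      have "j \<in> {x\<in>B. precedes \<sigma> x i} - {x\<in>B. precedes \<sigma> x j}" using j by simp
      moreover have "{x\<in>B. precedes \<sigma> x j} \<subseteq> {x\<in>B. precedes \<sigma> x i}"
        using j precedes_trans by blast
      ultimately show "{x\<in>B. precedes \<sigma> x j} \<subset> {x\<in>B. precedes \<sigma> x i}" by blast
    qed (use run.fin in simp)
    ultimately have "run'.off j = run.off j" using less.hyps by blast
    then show ?thesis using agree[OF \<open>j \<in> run.P\<close> lt] by linarith
  qed
  then have "run'.off i = run.off i"
    unfolding offset_def using same_precedes[OF iB] by (intro sum.cong) auto
  then show ?case using less.prems same_ser[OF iB] by (auto simp: par_set_def)
qed

text \<open>All parallel completions are observed, so \<open>run.P\<close> is contained in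
  \<open>run'.P\<close>. Conversely, a task left over comes after all of \<open>run.P\<close>, so in
  the other run its offset is at least \<open>run.plen\<close>, which by \<open>R_le_plen\<close> is
  at least its serial work.\<close>

lemma same_par:
  assumes "run.plen < t"
  shows "run'.P = run.P" "run'.plen = run.plen" "run'.slen = run.slen"
proof -
  have P: "j \<in> run'.P \<and> \<pi>' j / p = \<pi> j / p" if j: "j \<in> run.P" for j
  proof -
    have "run.off j + \<pi> j / p < t" using run.P_off_le[OF j] assms by linarith
    moreover have "0 < \<pi> j / p" using j run.P_sub run.\<pi>_pos run.p_pos by auto
    ultimately show ?thesis using agree[OF j] same_offset[OF j] by linarith
  qed
  have len: "(\<Sum>j\<in>run.P. \<pi>' j / p) = run.plen"
    unfolding par_len_def by (rule sum.cong[OF refl]) (use P in blast)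
  have "i \<notin> run'.P" if i: "i \<in> run.R" for i
  proof -
    have iB: "i \<in> B" using i by blast
    have pre: "precedes \<sigma>' j i" if "j \<in> run.P" for j
    proof -
      have "\<not> precedes \<sigma> i j" "j \<noteq> i" using run.P_down[OF that iB] that i by auto
      then have "precedes \<sigma> j i" using precedes_total[of j i \<sigma>] by blast
      then show ?thesis using same_precedes[OF iB] that run.P_sub by blast
    qed
    have "\<sigma>' i \<le> run.plen" using run.R_le_plen i same_ser[OF iB] by simp
    also have "\<dots> = (\<Sum>j\<in>run.P. \<pi>' j / p)" by (rule len[symmetric])
    also have "\<dots> \<le> run'.off i"
      unfolding offset_def using run.fin pre run.P_sub run'.\<pi>_pos run.p_pos
      by (intro sum_mono2) (auto simp: less_imp_le)
    finally show ?thesis by (auto simp: par_set_def)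
  qed
  then show PP: "run'.P = run.P" using P run.P_sub run'.P_sub by blast
  then show "run'.plen = run.plen"
    using len by (simp only: par_len_def)
  have "\<sigma>' ` run.R = \<sigma> ` run.R" "sum \<sigma>' run.R = sum \<sigma> run.R"
    using same_ser by (auto intro!: image_cong sum.cong)
  then show "run'.slen = run.slen" unfolding PP ser_len_def by simp
qed

end

section \<open>Definition of the batching scheduler\<close>

definition arrived :: "task list \<Rightarrow> real \<Rightarrow> nat" where
  "arrived T t = card {i. i < length T \<and> arr (T ! i) \<le> t}"

text \<open>If no task is pending, the scheduler waits for the next arrival. After the last task the
  value \<open>e\<close> merely continues the sequence with empty batches.\<close>

definition batch_start :: "task list \<Rightarrow> nat \<Rightarrow> real \<Rightarrow> real" where
  "batch_start T n e = (if n < length T then max e (arr (T ! n)) else e)"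

text \<open>The state \<open>(n, e)\<close> before batch \<open>k\<close>: the tasks of index below \<open>n\<close> have been processed, and
  this was finished at time \<open>e\<close>.\<close>

primrec batch_state :: "nat \<Rightarrow> task list \<Rightarrow> nat \<Rightarrow> nat \<times> real" where
  "batch_state p T 0 = (0, 0)"
| "batch_state p T (Suc k) =
     (let n = fst (batch_state p T k); s = batch_start T n (snd (batch_state p T k));
          m = arrived T s
      in (m, s + batch_len p (\<lambda>i. ser (T ! i)) (\<lambda>i. par (T ! i)) {n..<m}))"

definition first :: "nat \<Rightarrow> task list \<Rightarrow> nat \<Rightarrow> nat" where
  "first p T k = fst (batch_state p T k)"

definition stop :: "nat \<Rightarrow> task list \<Rightarrow> nat \<Rightarrow> real" where
  "stop p T k = snd (batch_state p T k)"

definition strt :: "nat \<Rightarrow> task list \<Rightarrow> nat \<Rightarrow> real" where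
  "strt p T k = batch_start T (first p T k) (stop p T k)"

definition members :: "nat \<Rightarrow> task list \<Rightarrow> nat \<Rightarrow> nat set" where
  "members p T k = {first p T k..<first p T (Suc k)}"

definition batch_of :: "nat \<Rightarrow> task list \<Rightarrow> nat \<Rightarrow> nat" where
  "batch_of p T i = (LEAST k. i < first p T (Suc k))"

definition pset :: "nat \<Rightarrow> task list \<Rightarrow> nat \<Rightarrow> nat set" where
  "pset p T k = par_set p (\<lambda>i. ser (T ! i)) (\<lambda>i. par (T ! i)) (members p T k)"

definition poff :: "nat \<Rightarrow> task list \<Rightarrow> nat \<Rightarrow> nat \<Rightarrow> real" where
  "poff p T k i = offset p (\<lambda>i. ser (T ! i)) (\<lambda>i. par (T ! i)) (members p T k) i"

definition plen :: "nat \<Rightarrow> task list \<Rightarrow> nat \<Rightarrow> real" where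
  "plen p T k = par_len p (\<lambda>i. ser (T ! i)) (\<lambda>i. par (T ! i)) (members p T k)"

definition slen :: "nat \<Rightarrow> task list \<Rightarrow> nat \<Rightarrow> real" where
  "slen p T k = ser_len p (\<lambda>i. ser (T ! i)) (members p T k - pset p T k)"

definition parallel :: "nat \<Rightarrow> task list \<Rightarrow> nat \<Rightarrow> bool" where
  "parallel p T i \<longleftrightarrow> i \<in> pset p T (batch_of p T i)"

definition from_time :: "nat \<Rightarrow> task list \<Rightarrow> nat \<Rightarrow> real" where
  "from_time p T i = (let k = batch_of p T i in
     strt p T k + (if parallel p T i then poff p T k i else plen p T k))"

definition to_time :: "nat \<Rightarrow> task list \<Rightarrow> nat \<Rightarrow> real" where
  "to_time p T i = from_time p T i +
     (if parallel p T i then par (T ! i) / p else slen p T (batch_of p T i))"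

definition rate :: "nat \<Rightarrow> task list \<Rightarrow> nat \<Rightarrow> real" where
  "rate p T i = (if parallel p T i then p else ser (T ! i) / slen p T (batch_of p T i))"

text \<open>The definition consults the parallel works freely; that the schedule depends only on
  observed completions is shown in \<open>online_batching\<close>. The intervals are half-open
  because \<open>valid\<close> forbids allocation at the completion time.\<close>

definition batching :: "nat \<Rightarrow> task list \<Rightarrow> schedule" where
  "batching p T = (parallel p T, \<lambda>i t.
     if i < length T \<and> from_time p T i \<le> t \<and> t < to_time p T i then rate p T i else 0)"

lemma first_0 [simp]: "first p T 0 = 0" and stop_0 [simp]: "stop p T 0 = 0"
  by (auto simp: first_def stop_def)

lemma first_Suc: "first p T (Suc k) = arrived T (strt p T k)"
  by (simp add: first_def stop_def strt_def Let_def)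

lemma stop_Suc: "stop p T (Suc k) = strt p T k + (plen p T k + slen p T k)"
  by (simp add: first_def stop_def strt_def Let_def plen_def slen_def members_def pset_def
      batch_len_def)

section \<open>Allocations of constant rate on one interval\<close>

lemma step_has_integral:
  fixes u v c t :: real
  assumes "0 \<le> u" "u < v"
  shows "((\<lambda>x. if u \<le> x \<and> x < v then c else 0) has_integral c * max 0 (min t v - u)) {0..t}"
proof -
  define w where "w = min t v"
  have "((\<lambda>_. c) has_integral c * max 0 (w - u)) {u..w}"
  proof (cases "u \<le> w")
    case True
    then show ?thesis using has_integral_const_real[of c u w] by (simp add: mult.commute)
  next
    case False
    then show ?thesis by simp
  qed
  moreover have "{u..w} \<subseteq> {0..t}" using assms by (auto simp: w_def)
  ultimately have "((\<lambda>x. if x \<in> {u..w} then c else 0) has_integral c * max 0 (w - u)) {0..t}"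
    by (subst has_integral_restrict)
  \<comment> \<open>On \<open>{0..t}\<close> the two integrands differ at most at the point
    \<open>v\<close>.\<close>
  then show ?thesis
    unfolding w_def
    by (rule has_integral_spike_finite[where S = "{v}", rotated 2]) auto
qed

text \<open>The work done is 0 up to \<open>u\<close>, linear up to \<open>v\<close> and constant
  afterwards, so the infima in \<open>comp\<close> and \<open>start\<close> are those of
  \<open>{v..}\<close> and \<open>{u<..}\<close>.\<close>

lemma constant_rate:
  assumes X: "snd X i = (\<lambda>x. if u \<le> x \<and> x < v then c else 0)"
    and uv: "0 \<le> u" "u < v" and c: "0 < c" and w: "work T X i = c * (v - u)"
  shows "snd X i integrable_on {0..t}" "comp T X i = v" "start X i = u"
    "work T X i \<le> done_work X i v"
proof -
  have d: "done_work X i t = c * max 0 (min t v - u)" for t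
    unfolding done_work_def X using step_has_integral[OF uv] by (rule integral_unique)
  show "snd X i integrable_on {0..t}"
    unfolding X using step_has_integral[OF uv] by (rule has_integral_integrable)
  have "{t. work T X i \<le> done_work X i t} = {v..}"
    unfolding d w using c uv by (auto simp: max_def min_def split: if_splits)
  then show "comp T X i = v" by (simp add: comp_def)
  have "{t. 0 < done_work X i t} = {u<..}"
    unfolding d using c uv by (auto simp: max_def min_def zero_less_mult_iff)
  then show "start X i = u" by (simp add: start_def)
  show "work T X i \<le> done_work X i v" unfolding d w using uv by simp
qed

lemma fmeasurable_intervals:
  fixes a b :: "'i \<Rightarrow> real"
  assumes "finite A"
  shows "(\<Union>i\<in>A. {a i..<b i}) \<in> fmeasurable lborel"
proof (rule fmeasurable.finite_UN[OF assms])
  show "{a i..<b i} \<in> fmeasurable lborel" for i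
    by (cases "a i \<le> b i") (auto intro!: fmeasurableI)
qed

section \<open>Batches of an arrival process and validity of the schedule\<close>

locale tap =
  fixes p :: nat and T :: "task list"
  assumes p: "1 \<le> p" and wf: "wf_tap p T"
begin

lemma task:
  assumes "i < length T"
  shows "0 \<le> arr (T ! i)" "0 < ser (T ! i)" "ser (T ! i) \<le> par (T ! i)"
    "par (T ! i) \<le> real p * ser (T ! i)"
  using wf nth_mem[OF assms] unfolding wf_tap_def by blast+

lemma arr_mono: "i \<le> j \<Longrightarrow> j < length T \<Longrightarrow> arr (T ! i) \<le> arr (T ! j)"
  using wf unfolding wf_tap_def sorted_iff_nth_mono by auto

text \<open>As the list is sorted by arrival, the arrived indices form an initial segment, whose
  length is their number. This makes every batch an interval of indices.\<close>

lemma less_arrived: "i < arrived T t \<longleftrightarrow> i < length T \<and> arr (T ! i) \<le> t"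
proof -
  define A where "A = {i. i < length T \<and> arr (T ! i) \<le> t}"
  have fin: "finite A" by (simp add: A_def)
  have down: "j \<in> A" if "i \<in> A" "j \<le> i" for i j
    using that arr_mono[of j i] by (auto simp: A_def)
  have "A = {..<card A}"
  proof (rule card_subset_eq[symmetric, THEN sym])
    show "A \<subseteq> {..<card A}"
    proof
      fix i assume "i \<in> A"
      then have "{..i} \<subseteq> A" using down by auto
      from card_mono[OF fin this] show "i \<in> {..<card A}" by simp
    qed
  qed auto
  then show ?thesis unfolding arrived_def A_def by blast
qed

lemma arrived_mono: "s \<le> t \<Longrightarrow> arrived T s \<le> arrived T t"
  by (meson less_arrived linorder_not_le order_less_irrefl order_trans)

lemma batch: 
  assumes "B \<subseteq> {..<length T}"
  shows "batch p (\<lambda>i. ser (T ! i)) (\<lambda>i. par (T ! i)) B"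
  using assms p task by unfold_locales (auto intro: finite_subset)

lemma first_le: "first p T k \<le> length T"
proof (cases k)
  case (Suc l)
  then show ?thesis using less_arrived[of "length T"] by (auto simp: first_Suc not_less[symmetric])
qed simp

lemma members_sub: "members p T k \<subseteq> {..<length T}"
  unfolding members_def using first_le[of "Suc k"] by auto

sublocale mem: batch p "\<lambda>i. ser (T ! i)" "\<lambda>i. par (T ! i)" "members p T k"
  rewrites "offset p (\<lambda>i. ser (T ! i)) (\<lambda>i. par (T ! i)) (members p T k) = poff p T k"
    and "par_set p (\<lambda>i. ser (T ! i)) (\<lambda>i. par (T ! i)) (members p T k) = pset p T k"
    and "par_len p (\<lambda>i. ser (T ! i)) (\<lambda>i. par (T ! i)) (members p T k) = plen p T k"
    and "ser_len p (\<lambda>i. ser (T ! i)) (members p T k - pset p T k) = slen p T k"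
  for k
  using batch[OF members_sub] by (auto simp: poff_def pset_def plen_def slen_def)

lemma stop_le_strt: "stop p T k \<le> strt p T k"
  by (auto simp: strt_def batch_start_def)

lemma strt_le_stop: "strt p T k \<le> stop p T (Suc k)"
  unfolding stop_Suc using mem.plen_nonneg[of k] mem.slen_nonneg[of k] by linarith

lemma strt_mono: "k \<le> l \<Longrightarrow> strt p T k \<le> strt p T l"
  by (rule lift_Suc_mono_le[of "strt p T"]) (meson order_trans strt_le_stop stop_le_strt)

lemma strt_nonneg: "0 \<le> strt p T k"
  using strt_mono[of 0 k] stop_le_strt[of 0] by simp

lemma first_mono: "k \<le> l \<Longrightarrow> first p T k \<le> first p T l"
proof (rule lift_Suc_mono_le[of "first p T"])
  show "first p T n \<le> first p T (Suc n)" for n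
    by (cases n) (auto simp: first_Suc intro!: arrived_mono strt_mono)
qed

text \<open>A batch does not start before its first pending task has arrived, so it takes at least
  that task.\<close>

lemma first_strict: 
  assumes "first p T k < length T"
  shows "first p T k < first p T (Suc k)"
  unfolding first_Suc less_arrived using assms by (auto simp: strt_def batch_start_def)

text \<open>Progress by at least one task per batch: \<open>length T\<close> batches process
  everything.\<close>

lemma first_ge: "min k (length T) \<le> first p T k"
proof (induction k)
  case (Suc k)
  then show ?case using first_strict[of k] first_mono[of k "Suc k"] by linarith
qed simp

lemma batch_of_eq:
  assumes "i \<in> members p T k"
  shows "batch_of p T i = k"
  unfolding batch_of_def
proof (rule Least_equality)
  show "i < first p T (Suc k)" using assms by (simp add: members_def)
  fix l assume "i < first p T (Suc l)"
  then have "first p T k < first p T (Suc l)" using assms by (simp add: members_def)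
  then show "k \<le> l" using first_mono[of "Suc l" k] by linarith
qed

lemma batch_of:
  assumes "i < length T"
  shows "i \<in> members p T (batch_of p T i)" "batch_of p T i < length T"
proof -
  let ?k = "batch_of p T i"
  have "min (Suc i) (length T) \<le> first p T (Suc i)" by (rule first_ge)
  then have ex: "i < first p T (Suc i)" using assms by simp
  then have "i < first p T (Suc ?k)" unfolding batch_of_def by (rule LeastI)
  moreover have "first p T ?k \<le> i"
  proof (cases ?k)
    case (Suc l)
    then have "\<not> i < first p T (Suc l)"
      using not_less_Least[of l "\<lambda>k. i < first p T (Suc k)"] by (simp add: batch_of_def)
    then show ?thesis using Suc by simp
  qed simp
  ultimately show "i \<in> members p T ?k" by (simp add: members_def)
  have "?k \<le> i" unfolding batch_of_def using ex by (rule Least_le)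
  then show "?k < length T" using assms by simp
qed

lemma members_arr:
  assumes "i \<in> members p T k"
  shows "i < length T" "arr (T ! i) \<le> strt p T k"
  using assms less_arrived by (auto simp: members_def first_Suc)

text \<open>A task present at the start of batch \<open>k\<close> would have been taken by that
  batch or an earlier one.\<close>

lemma members_arr_gt:
  assumes "i \<in> members p T (Suc k)"
  shows "strt p T k < arr (T ! i)"
  using assms less_arrived[of i "strt p T k"] members_arr(1)[OF assms]
  by (auto simp: members_def first_Suc)

lemma interval:
  assumes "i \<in> members p T k"
  shows "strt p T k \<le> from_time p T i" "from_time p T i < to_time p T i"
    "to_time p T i \<le> stop p T (Suc k)" "0 < rate p T i"
    "rate p T i * (to_time p T i - from_time p T i) = work T (batching p T) i"
proof -
  have b: "batch_of p T i = k" using assms by (rule batch_of_eq)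
  have pos: "0 < par (T ! i) / p" using mem.\<pi>_pos[OF assms] p by simp
  have R: "i \<in> members p T k - pset p T k" if "\<not> parallel p T i"
    using that assms b by (simp add: parallel_def)
  show "strt p T k \<le> from_time p T i"
    using mem.off_nonneg mem.plen_nonneg by (simp add: from_time_def b)
  show "from_time p T i < to_time p T i"
    using pos mem.slen_pos R by (auto simp: to_time_def b)
  show "to_time p T i \<le> stop p T (Suc k)"
    using mem.P_off_le[of i k] mem.slen_nonneg[of k]
    by (auto simp: to_time_def from_time_def stop_Suc b parallel_def)
  show "0 < rate p T i"
    using p R mem.slen_pos mem.\<sigma>_pos[OF assms] by (auto simp: rate_def b)
  show "rate p T i * (to_time p T i - from_time p T i) = work T (batching p T) i"
    using p R mem.slen_pos by (force simp: rate_def to_time_def b work_def batching_def)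
qed

lemma run:
  assumes "i < length T"
  shows "snd (batching p T) i integrable_on {0..t}" "comp T (batching p T) i = to_time p T i"
    "start (batching p T) i = from_time p T i"
    "work T (batching p T) i \<le> done_work (batching p T) i (to_time p T i)"
proof -
  note iv = interval[OF batch_of(1)[OF assms]]
  have X: "snd (batching p T) i =
      (\<lambda>x. if from_time p T i \<le> x \<and> x < to_time p T i then rate p T i else 0)"
    using assms by (auto simp: batching_def)
  have "0 \<le> from_time p T i" using iv(1) strt_nonneg order_trans by blast
  note * = constant_rate[OF X this iv(2,4) iv(5)[symmetric]]
  show "snd (batching p T) i integrable_on {0..t}" "comp T (batching p T) i = to_time p T i"
    "start (batching p T) i = from_time p T i"
    "work T (batching p T) i \<le> done_work (batching p T) i (to_time p T i)"
    by (fact *)+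
qed

lemma running_same_batch:
  assumes i: "i \<in> members p T k" "from_time p T i \<le> t" "t < to_time p T i"
    and j: "j \<in> members p T l" "from_time p T j \<le> t" "t < to_time p T j"
  shows "k = l"
proof -
  have "\<not> k < l" if "i \<in> members p T k" "t < to_time p T i"
    "j \<in> members p T l" "from_time p T j \<le> t" for i j k l
  proof
    assume "k < l"
    then have "stop p T (Suc k) \<le> strt p T l"
      using stop_le_strt[of "Suc k"] strt_mono[of "Suc k" l] by simp
    then show False using interval(3)[OF that(1)] interval(1)[OF that(3)] that by linarith
  qed
  then show ?thesis using i j by (meson linorder_neqE_nat)
qed

text \<open>Two parallel jobs are separated by \<open>off_step\<close>, and serial jobs start only
  at \<open>plen\<close>, when all parallel jobs have ended.\<close>

lemma running_parallel_alone:
  assumes i: "i \<in> pset p T k" "from_time p T i \<le> t" "t < to_time p T i"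
    and j: "j \<in> members p T k" "from_time p T j \<le> t" "t < to_time p T j"
  shows "j = i"
proof (rule ccontr)
  assume ne: "j \<noteq> i"
  have iB: "i \<in> members p T k" using i mem.P_sub by blast
  note b = batch_of_eq[OF iB] batch_of_eq[OF j(1)]
  show False
  proof (cases "j \<in> pset p T k")
    case True
    then show False
      using precedes_total[OF ne, of "\<lambda>i. ser (T ! i)"] mem.off_step[OF iB, of j] mem.off_step[OF j(1), of i] i j
      by (auto simp: from_time_def to_time_def b parallel_def)
  next
    case False
    then show False using mem.P_off_le[OF i(1)] i j
      by (auto simp: from_time_def to_time_def b parallel_def)
  qed
qed

text \<open>At any instant either one parallel job holds all processors, or only serial jobs of one
  batch run. The rates of the latter sum to at most \<open>p\<close> because \<open>slen\<close> is
  at least their total work divided by \<open>p\<close>.\<close>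

lemma total_le: "(\<Sum>i<length T. snd (batching p T) i t) \<le> real p"
proof -
  define A where "A = {i. i < length T \<and> from_time p T i \<le> t \<and> t < to_time p T i}"
  have "(\<Sum>i<length T. snd (batching p T) i t) = (\<Sum>i\<in>A. rate p T i)"
    by (rule sum.mono_neutral_cong_right) (auto simp: A_def batching_def)
  also have "\<dots> \<le> real p"
  proof (cases "A = {}")
    case False
    then obtain i where i: "i \<in> A" by blast
    define k where "k = batch_of p T i"
    have ik: "i \<in> members p T k" using i batch_of by (simp add: A_def k_def)
    have A_sub: "A \<subseteq> members p T k"
    proof
      fix j assume "j \<in> A"
      then show "j \<in> members p T k"
        using running_same_batch[OF ik, of t j "batch_of p T j"] i batch_of by (simp add: A_def)
    qed
    show ?thesis
    proof (cases "A \<inter> pset p T k = {}")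
      case True
      then have R: "A \<subseteq> members p T k - pset p T k" using A_sub by blast
      have pos: "0 < slen p T k" using mem.slen_pos R i by blast
      have "(\<Sum>i\<in>A. rate p T i) = (\<Sum>i\<in>A. ser (T ! i) / slen p T k)"
        using R by (intro sum.cong) (auto simp: rate_def parallel_def batch_of_eq)
      also have "\<dots> \<le> (\<Sum>i\<in>members p T k - pset p T k. ser (T ! i) / slen p T k)"
        using R mem.fin mem.\<sigma>_pos pos by (intro sum_mono2) (auto simp: less_imp_le)
      also have "\<dots> \<le> p"
        using mem.slen_ge(1)[of k] pos p by (simp add: sum_divide_distrib[symmetric] field_simps)
      finally show ?thesis .
    next
      case False
      then obtain j where j: "j \<in> A" "j \<in> pset p T k" by blast
      then have "A = {j}"
        using running_parallel_alone[OF j(2)] A_sub by (auto simp: A_def)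
      then show ?thesis using j A_sub by (simp add: rate_def parallel_def batch_of_eq)
    qed
  qed simp
  finally show ?thesis .
qed

lemma valid_batching: "valid p T (batching p T)"
  unfolding valid_def
proof (intro conjI allI impI)
  fix i t
  show "0 \<le> snd (batching p T) i t"
    using interval(4)[OF batch_of(1), of i] by (auto simp: batching_def)
  show "snd (batching p T) i integrable_on {0..t}"
  proof (cases "i < length T")
    case False
    then show ?thesis by (simp add: batching_def integrable_0)
  qed (rule run)
  show "(\<Sum>i<length T. snd (batching p T) i t) \<le> real p" by (rule total_le)
next
  fix i t assume nz: "snd (batching p T) i t \<noteq> 0"
  then show i: "i < length T" by (auto simp: batching_def split: if_splits)
  show "arr (T ! i) \<le> t"
    using nz interval(1)[OF batch_of(1)[OF i]] members_arr(2)[OF batch_of(1)[OF i]]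
    by (auto simp: batching_def split: if_splits)
  show "t < comp T (batching p T) i"
    using nz by (auto simp: run(2)[OF i]) (auto simp: batching_def split: if_splits)
next
  fix i t assume ser: "\<not> fst (batching p T) i"
  show "snd (batching p T) i t \<le> 1"
  proof (cases "i < length T")
    case True
    let ?k = "batch_of p T i"
    have R: "i \<in> members p T ?k - pset p T ?k"
      using True batch_of ser by (auto simp: batching_def parallel_def)
    then show ?thesis using mem.slen_ge(2)[OF R] mem.slen_pos[OF R]
      by (auto simp: batching_def rate_def parallel_def)
  qed (auto simp: batching_def)
next
  fix i assume "i < length T"
  then show "\<exists>t. work T (batching p T) i \<le> done_work (batching p T) i t" using run(4) by blast
qed

text \<open>The scheduler is never idle while a task is alive: a task waits at most during the batch
  preceding its own.\<close>

lemma awake_batching: "awake T (batching p T) \<le> (\<Sum>k<length T. plen p T k + slen p T k)"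
proof -
  have sub: "(\<Union>i<length T. {arr (T ! i)..<comp T (batching p T) i})
      \<subseteq> (\<Union>k<length T. {strt p T k..<stop p T (Suc k)})"
  proof
    fix x assume "x \<in> (\<Union>i<length T. {arr (T ! i)..<comp T (batching p T) i})"
    then obtain i where i: "i < length T" "arr (T ! i) \<le> x" "x < to_time p T i"
      by (auto simp: run(2))
    define k where "k = batch_of p T i"
    have k: "i \<in> members p T k" "k < length T" using batch_of[OF i(1)] by (auto simp: k_def)
    have x: "x < stop p T (Suc k)" using interval(3)[OF k(1)] i by linarith
    show "x \<in> (\<Union>k<length T. {strt p T k..<stop p T (Suc k)})"
    proof (cases "strt p T k \<le> x")
      case True
      then show ?thesis using x k by auto
    next
      case False
      \<comment> \<open>The first task of batch \<open>k\<close> has arrived by \<open>x\<close> as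
        well, so only the end of the preceding batch can delay the start of batch \<open>k\<close>
        beyond \<open>x\<close>.\<close>
      have "first p T k \<le> i" using k by (simp add: members_def)
      then have "arr (T ! first p T k) \<le> x" using arr_mono[OF _ i(1)] i(2) order_trans by blast
      then have xs: "x < stop p T k"
        using False i(1) \<open>first p T k \<le> i\<close> by (auto simp: strt_def batch_start_def max_def split: if_splits)
      then obtain l where l: "k = Suc l"
        using task(1)[OF i(1)] i(2) by (cases k) auto
      then have "strt p T l \<le> x" using members_arr_gt k(1) i(2) by force
      then show ?thesis using xs k(2) l by auto
    qed
  qed
  have "awake T (batching p T) \<le> measure lborel (\<Union>k<length T. {strt p T k..<stop p T (Suc k)})"
    unfolding awake_def
    by (rule measure_mono_fmeasurable[OF sub]) (auto intro!: fmeasurable_intervals)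
  also have "\<dots> \<le> (\<Sum>k<length T. measure lborel {strt p T k..<stop p T (Suc k)})"
    by (rule measure_UNION_le) auto
  also have "\<dots> = (\<Sum>k<length T. plen p T k + slen p T k)"
    using strt_le_stop by (intro sum.cong) (auto simp: stop_Suc)
  finally show ?thesis .
qed

end

section \<open>Comparison with an arbitrary valid schedule\<close>

lemma work_le_measure:
  assumes X: "valid p T X" and A: "A \<subseteq> {..<length T}" and arr: "\<And>i. i \<in> A \<Longrightarrow> 0 \<le> arr (T ! i)"
    and c: "\<And>t. (\<Sum>i\<in>A. snd X i t) \<le> c"
  shows "(\<Sum>i\<in>A. work T X i) \<le> c * measure lborel (\<Union>i\<in>A. {arr (T ! i)..<comp T X i})"
proof -
  define V where "V = (\<Union>i\<in>A. {arr (T ! i)..<comp T X i})"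
  have fin: "finite A" using A finite_subset by blast
  have nonneg: "0 \<le> snd X i t" for i t using X by (simp add: valid_def)
  have int: "snd X i integrable_on {0..t}" for i t using X by (simp add: valid_def)
  obtain f where f: "\<And>i. i \<in> A \<Longrightarrow> work T X i \<le> done_work X i (f i)"
    using X A unfolding valid_def by (metis lessThan_iff subsetD)
  \<comment> \<open>A horizon by which all tasks of \<open>A\<close> have received their work and
    completed; the 0 covers empty \<open>A\<close>.\<close>
  define t where "t = Max (insert 0 (f ` A \<union> comp T X ` A))"
  have t: "f i \<le> t" "comp T X i \<le> t" if "i \<in> A" for i
    using that fin by (auto simp: t_def intro!: Max_ge)
  have V_sub: "V \<subseteq> {0..t}" using arr t(2) by (force simp: V_def)
  have V_meas: "V \<in> fmeasurable lborel" unfolding V_def using fin by (auto intro!: fmeasurable_intervals)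
  have "((\<lambda>x. 1) has_integral measure lborel V) V"
    using V_meas by (intro has_integral_measure_lborel) (auto simp: fmeasurable_def)
  then have "((\<lambda>x. if x \<in> V then 1 else 0) has_integral measure lborel V) {0..t}"
    using V_sub by (subst has_integral_restrict)
  then have hi: "((\<lambda>x. c * (if x \<in> V then 1 else 0)) has_integral c * measure lborel V) {0..t}"
    by (rule has_integral_mult_right)
  have "(\<Sum>i\<in>A. work T X i) \<le> (\<Sum>i\<in>A. integral {0..t} (snd X i))"
  proof (rule sum_mono)
    fix i assume i: "i \<in> A"
    have "integral {0..f i} (snd X i) \<le> integral {0..t} (snd X i)"
      using t(1)[OF i] int nonneg by (intro integral_subset_le) auto
    then show "work T X i \<le> integral {0..t} (snd X i)"
      using f[OF i] by (simp add: done_work_def)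
  qed
  also have "\<dots> = integral {0..t} (\<lambda>x. \<Sum>i\<in>A. snd X i x)"
    using fin int by (simp add: integral_sum)
  also have "\<dots> \<le> integral {0..t} (\<lambda>x. c * (if x \<in> V then 1 else 0))"
  proof (rule integral_le)
    show "(\<lambda>x. \<Sum>i\<in>A. snd X i x) integrable_on {0..t}"
      using fin int by (intro integrable_sum) auto
    show "(\<lambda>x. c * (if x \<in> V then 1 else 0)) integrable_on {0..t}"
      using hi by (rule has_integral_integrable)
    fix x
    \<comment> \<open>Processors are given to a task only while it is alive, so all work on
      \<open>A\<close> falls into \<open>V\<close>.\<close>
    have "(\<Sum>i\<in>A. snd X i x) = 0" if "x \<notin> V"
    proof (rule sum.neutral, rule)
      fix i assume "i \<in> A"
      then show "snd X i x = 0" using that X unfolding V_def valid_def by fastforce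
    qed
    then show "(\<Sum>i\<in>A. snd X i x) \<le> c * (if x \<in> V then 1 else 0)" using c[of x] by auto
  qed
  also have "\<dots> = c * measure lborel V" using hi by (rule integral_unique)
  finally show ?thesis by (simp add: V_def)
qed

context tap
begin

lemma batch_len_le_alive:
  fixes k
  assumes X: "valid p T X"
  defines "V \<equiv> (\<Union>i\<in>members p T k. {arr (T ! i)..<comp T X i})"
  shows "plen p T k + slen p T k \<le> 3 * measure lborel V"
proof -
  have nonneg: "0 \<le> snd X i t" for i t using X by (simp add: valid_def)
  have V_meas: "V \<in> fmeasurable lborel"
    unfolding V_def using mem.fin by (auto intro!: fmeasurable_intervals)
  have "batch_len p (\<lambda>i. ser (T ! i)) (\<lambda>i. par (T ! i)) (members p T k) \<le> 3 * measure lborel V"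
  proof (rule mem.batch_len_bound[where c = "fst X"])
    fix i assume i: "i \<in> members p T k" "\<not> fst X i"
    then have len: "i < length T" using members_sub by blast
    \<comment> \<open>A serial job alone has rate at most 1; for the whole batch the rate bound is
      \<open>p\<close>.\<close>
    have "(\<Sum>i\<in>{i}. work T X i) \<le> 1 * measure lborel (\<Union>i\<in>{i}. {arr (T ! i)..<comp T X i})"
      using X len i task(1) by (intro work_le_measure) (auto simp: valid_def)
    then have "ser (T ! i) \<le> measure lborel {arr (T ! i)..<comp T X i}"
      using i by (simp add: work_def)
    also have "\<dots> \<le> measure lborel V"
      using i V_meas by (intro measure_mono_fmeasurable) (auto simp: V_def)
    finally show "ser (T ! i) \<le> measure lborel V" .
  next
    have "(\<Sum>i\<in>members p T k. work T X i) \<le> real p * measure lborel V"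
      unfolding V_def
    proof (rule work_le_measure[OF X members_sub])
      show "(\<Sum>i\<in>members p T k. snd X i t) \<le> real p" for t
      proof -
        have "(\<Sum>i\<in>members p T k. snd X i t) \<le> (\<Sum>i<length T. snd X i t)"
          using members_sub nonneg by (intro sum_mono2) auto
        then show ?thesis using X unfolding valid_def by (meson order_trans)
      qed
    qed (use members_sub task(1) in blast)
    then show "(\<Sum>i\<in>members p T k. if fst X i then par (T ! i) else ser (T ! i))
        \<le> real p * measure lborel V"
      by (simp add: work_def)
  qed simp
  then show ?thesis by (simp add: batch_len_def pset_def[symmetric] plen_def slen_def)
qed

lemma batch_len_le_window:
  fixes k
  assumes X: "valid p T X"
  defines "U \<equiv> (\<Union>i<length T. {arr (T ! i)..<comp T X i})"
  defines "lo \<equiv> (case k of 0 \<Rightarrow> 0 | Suc l \<Rightarrow> strt p T l)"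
  shows "plen p T k + slen p T k \<le> 3 * measure lborel (U \<inter> {lo..<strt p T (Suc k)})"
proof -
  let ?W = "U \<inter> {lo..<strt p T (Suc k)}"
  have U: "U \<in> fmeasurable lborel" unfolding U_def by (auto intro!: fmeasurable_intervals)
  then have W: "?W \<in> fmeasurable lborel" by (rule fmeasurable_Int_fmeasurable) auto
  \<comment> \<open>For the first batch the default 0 works since arrival times are
    nonnegative.\<close>
  have lo: "lo \<le> arr (T ! i)" if "i \<in> members p T k" for i
    using that members_arr_gt members_arr(1) task(1)
    by (cases k) (force simp: lo_def)+
  show ?thesis
  proof (cases "\<exists>i\<in>members p T k. strt p T (Suc k) < comp T X i")
    case True
    then obtain i where i: "i \<in> members p T k" "strt p T (Suc k) < comp T X i" by blast
    note ar = members_arr[OF i(1)]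
    \<comment> \<open>Task \<open>i\<close> has arrived when batch \<open>k\<close> starts and is
      unfinished when the next one starts, so the competitor is awake all the time between.\<close>
    have sub: "{strt p T k..<strt p T (Suc k)} \<subseteq> ?W"
      using ar i lo[OF i(1)] by (force simp: U_def)
    have "plen p T k + slen p T k \<le> strt p T (Suc k) - strt p T k"
      using stop_le_strt[of "Suc k"] by (simp add: stop_Suc)
    also have "\<dots> = measure lborel {strt p T k..<strt p T (Suc k)}"
      using strt_mono[of k "Suc k"] by simp
    also have "\<dots> \<le> measure lborel ?W"
      using sub W by (intro measure_mono_fmeasurable) auto
    finally show ?thesis using measure_nonneg[of lborel ?W] by linarith
  next
    case False
    have "(\<Union>i\<in>members p T k. {arr (T ! i)..<comp T X i}) \<subseteq> ?W"
      using False lo members_sub[of k] by (fastforce simp: U_def)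
    then have "measure lborel (\<Union>i\<in>members p T k. {arr (T ! i)..<comp T X i}) \<le> measure lborel ?W"
      using W mem.fin by (intro measure_mono_fmeasurable) auto
    then show ?thesis using batch_len_le_alive[OF X, of k] by linarith
  qed
qed

lemma competitive:
  assumes X: "valid p T X"
  shows "awake T (batching p T) \<le> 6 * awake T X"
proof -
  define U where "U = (\<Union>i<length T. {arr (T ! i)..<comp T X i})"
  define lo where "lo = (\<lambda>k. case k of 0 \<Rightarrow> 0 | Suc l \<Rightarrow> strt p T l)"
  \<comment> \<open>The competitor's awake time before \<open>lo k\<close>. As
    \<open>lo (Suc (Suc k))\<close> is \<open>strt p T (Suc k)\<close>, the window of batch
    \<open>k\<close> is a difference of \<open>g\<close> at distance two.\<close>
  define g where "g = (\<lambda>k. measure lborel (U \<inter> {..<lo k}))"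
  have U: "U \<in> fmeasurable lborel" unfolding U_def by (auto intro!: fmeasurable_intervals)
  then have W: "U \<inter> I \<in> fmeasurable lborel" if "I \<in> sets lborel" for I
    using that by (rule fmeasurable_Int_fmeasurable)
  have g: "0 \<le> g k" "g k \<le> awake T X" for k
  proof -
    show "g k \<le> awake T X"
      unfolding g_def awake_def U_def[symmetric]
      using U by (intro measure_mono_fmeasurable) auto
  qed (simp add: g_def)
  have win: "measure lborel (U \<inter> {lo k..<strt p T (Suc k)}) = g (Suc (Suc k)) - g k" for k
  proof -
    have "lo k \<le> strt p T (Suc k)"
      using strt_nonneg strt_mono by (cases k) (auto simp: lo_def)
    then have "U \<inter> {..<strt p T (Suc k)} = (U \<inter> {..<lo k}) \<union> (U \<inter> {lo k..<strt p T (Suc k)})"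
      by auto
    moreover have "measure lborel ((U \<inter> {..<lo k}) \<union> (U \<inter> {lo k..<strt p T (Suc k)}))
        = measure lborel (U \<inter> {..<lo k}) + measure lborel (U \<inter> {lo k..<strt p T (Suc k)})"
      using fmeasurableD2[OF W] fmeasurableD[OF W] by (intro measure_Union) auto
    ultimately show ?thesis by (simp add: g_def lo_def)
  qed
  \<comment> \<open>Telescoping at distance two leaves two upper end terms, each at most
    \<open>awake T X\<close>; with the factor 3 this gives 6.\<close>
  have tele: "(\<Sum>k<N. g (Suc (Suc k)) - g k) = g (Suc N) + g N - g (Suc 0) - g 0" for N
    by (induction N) auto
  have "awake T (batching p T) \<le> (\<Sum>k<length T. plen p T k + slen p T k)"
    by (rule awake_batching)
  also have "\<dots> \<le> (\<Sum>k<length T. 3 * (g (Suc (Suc k)) - g k))"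
    using batch_len_le_window[OF X] unfolding win[symmetric]
    by (intro sum_mono) (simp add: U_def lo_def)
  also have "\<dots> = 3 * (g (Suc (length T)) + g (length T) - g (Suc 0) - g 0)"
    by (simp only: sum_distrib_left[symmetric] tele)
  also have "\<dots> \<le> 6 * awake T X"
    using g(1)[of 0] g(1)[of "Suc 0"] g(2)[of "Suc (length T)"] g(2)[of "length T"] by (smt (verit))
  finally show ?thesis .
qed

end

section \<open>Obliviousness: two arrival processes that look alike before \<open>t\<close>\<close>

locale indistinguishable = tap p T + other: tap p T'
  for p :: nat and T T' :: "task list" +
  fixes t :: real
  assumes info: "same_info (batching p) T T' t"
begin

lemma same_task:
  assumes "i < length T" "arr (T ! i) < t"
  shows "i < length T'" "arr (T' ! i) = arr (T ! i)" "ser (T' ! i) = ser (T ! i)"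
  using info assms unfolding same_info_def by metis+

lemma same_completion:
  assumes "i < length T" "parallel p T i" "to_time p T i < t"
  shows "i < length T'" "parallel p T' i" "to_time p T' i = to_time p T i"
proof -
  have par: "fst (batching p T) i" and lt: "comp T (batching p T) i < t"
    using assms run(2)[OF assms(1)] by (simp_all add: batching_def)
  have "i < length T' \<and> fst (batching p T') i \<and> comp T' (batching p T') i = comp T (batching p T) i"
    using info assms(1) par lt unfolding same_info_def by blast
  then have "i < length T' \<and> parallel p T' i \<and> comp T' (batching p T') i = comp T (batching p T) i"
    by (simp add: batching_def)
  then show "i < length T'" "parallel p T' i" "to_time p T' i = to_time p T i"
    using run(2)[OF assms(1)] other.run(2) by auto
qed

lemma same_completion':
  assumes "i < length T'" "parallel p T' i" "to_time p T' i < t"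
  shows "to_time p T' i = to_time p T i"
proof -
  have par: "fst (batching p T') i" and lt: "comp T' (batching p T') i < t"
    using assms other.run(2)[OF assms(1)] by (simp_all add: batching_def)
  have "i < length T \<and> comp T (batching p T) i = comp T' (batching p T') i"
    using info assms(1) par lt unfolding same_info_def by blast
  then show ?thesis using other.run(2)[OF assms(1)] run(2) by auto
qed

lemma same_arrived: 
  assumes "s < t"
  shows "arrived T' s = arrived T s"
proof -
  have "{i. i < length T' \<and> arr (T' ! i) \<le> s} = {i. i < length T \<and> arr (T ! i) \<le> s}"
    using info assms unfolding same_info_def by (smt (verit) Collect_cong)
  then show ?thesis by (simp add: arrived_def)
qed

lemma same_members:
  assumes k: "first p T k < length T" "strt p T k < t"
    and eq: "first p T' k = first p T k" "stop p T' k = stop p T k"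
  shows "strt p T' k = strt p T k" "members p T' k = members p T k"
    "first p T' (Suc k) = first p T (Suc k)"
proof -
  have "arr (T ! first p T k) < t"
    using k by (auto simp: strt_def batch_start_def)
  then show s: "strt p T' k = strt p T k"
    using same_task[OF k(1)] k(1) eq by (simp add: strt_def batch_start_def)
  then show f: "first p T' (Suc k) = first p T (Suc k)"
    using same_arrived k(2) by (simp add: first_Suc)
  then show "members p T' k = members p T k"
    using eq by (simp add: members_def)
qed

lemma same_batch:
  assumes k: "first p T k < length T" "strt p T k < t"
    and eq: "first p T' k = first p T k" "stop p T' k = stop p T k"
  shows "i \<in> pset p T k \<Longrightarrow> strt p T k + poff p T k i < t \<Longrightarrow>
      poff p T' k i = poff p T k i \<and> i \<in> pset p T' k"
    and "strt p T k + plen p T k < t \<Longrightarrow>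
      pset p T' k = pset p T k \<and> plen p T' k = plen p T k \<and> slen p T' k = slen p T k"
proof -
  note m = same_members[OF assms]
  \<comment> \<open>Times within the batch count from its start, so the observation horizon becomes
    \<open>t - strt p T k\<close>.\<close>
  interpret two_runs p "\<lambda>i. ser (T ! i)" "\<lambda>i. ser (T' ! i)" "\<lambda>i. par (T ! i)" "\<lambda>i. par (T' ! i)"
    "members p T k" "t - strt p T k"
    rewrites "offset p (\<lambda>i. ser (T ! i)) (\<lambda>i. par (T ! i)) (members p T k) = poff p T k"
      and "par_set p (\<lambda>i. ser (T ! i)) (\<lambda>i. par (T ! i)) (members p T k) = pset p T k"
      and "par_len p (\<lambda>i. ser (T ! i)) (\<lambda>i. par (T ! i)) (members p T k) = plen p T k"
      and "ser_len p (\<lambda>i. ser (T ! i)) (members p T k - pset p T k) = slen p T k"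
      and "offset p (\<lambda>i. ser (T' ! i)) (\<lambda>i. par (T' ! i)) (members p T k) = poff p T' k"
      and "par_set p (\<lambda>i. ser (T' ! i)) (\<lambda>i. par (T' ! i)) (members p T k) = pset p T' k"
      and "par_len p (\<lambda>i. ser (T' ! i)) (\<lambda>i. par (T' ! i)) (members p T k) = plen p T' k"
      and "ser_len p (\<lambda>i. ser (T' ! i)) (members p T k - pset p T' k) = slen p T' k"
  proof -
    have "two_runs_axioms p (\<lambda>i. ser (T ! i)) (\<lambda>i. ser (T' ! i)) (\<lambda>i. par (T ! i))
      (\<lambda>i. par (T' ! i)) (members p T k) (t - strt p T k)"
    proof
      fix j assume j: "j \<in> members p T k"
      show "ser (T' ! j) = ser (T ! j)"
        using same_task members_arr[OF j] k by simp
    next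
      fix j
      assume "j \<in> par_set p (\<lambda>i. ser (T ! i)) (\<lambda>i. par (T ! i)) (members p T k)"
        and "offset p (\<lambda>i. ser (T ! i)) (\<lambda>i. par (T ! i)) (members p T k) j + par (T ! j) / p
          < t - strt p T k"
      then have P: "j \<in> pset p T k" and lt: "strt p T k + poff p T k j + par (T ! j) / p < t"
        by (auto simp: pset_def poff_def)
      have j: "j \<in> members p T k" using P mem.P_sub by blast
      have b: "batch_of p T j = k" "batch_of p T' j = k"
        using batch_of_eq[OF j] other.batch_of_eq[of j k] m(2) j by auto
      have par: "parallel p T j" using P b by (simp add: parallel_def)
      then have to: "to_time p T j = strt p T k + poff p T k j + par (T ! j) / p"
        by (simp add: to_time_def from_time_def b)
      \<comment> \<open>A completion before \<open>t\<close> is visible through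
        \<open>same_info\<close>; this yields the assumption \<open>agree\<close>.\<close>
      note c = same_completion[OF members_arr(1)[OF j] par lt[folded to]]
      then have "to_time p T' j = strt p T k + poff p T' k j + par (T' ! j) / p"
        by (simp add: to_time_def from_time_def b m)
      then show "j \<in> par_set p (\<lambda>i. ser (T' ! i)) (\<lambda>i. par (T' ! i)) (members p T k) \<and>
         offset p (\<lambda>i. ser (T' ! i)) (\<lambda>i. par (T' ! i)) (members p T k) j + par (T' ! j) / p =
         offset p (\<lambda>i. ser (T ! i)) (\<lambda>i. par (T ! i)) (members p T k) j + par (T ! j) / p"
        using c to b m(2) by (simp add: parallel_def pset_def poff_def)
    qed
    then show "two_runs p (\<lambda>i. ser (T ! i)) (\<lambda>i. ser (T' ! i)) (\<lambda>i. par (T ! i))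
      (\<lambda>i. par (T' ! i)) (members p T k) (t - strt p T k)"
      using batch[OF members_sub] other.batch[OF other.members_sub, of k] m(2)
      by (simp add: two_runs_def)
  qed (auto simp: poff_def pset_def plen_def slen_def m(2))
  show "poff p T' k i = poff p T k i \<and> i \<in> pset p T' k"
    if "i \<in> pset p T k" "strt p T k + poff p T k i < t"
    using same_offset[of i] that by simp
  show "pset p T' k = pset p T k \<and> plen p T' k = plen p T k \<and> slen p T' k = slen p T k"
    if "strt p T k + plen p T k < t"
    using same_par that by simp
qed

text \<open>If batch \<open>Suc k\<close> starts before \<open>t\<close>, then the parallel phase of
  batch \<open>k\<close> ended before \<open>t\<close>, so \<open>same_batch\<close> determines its
  length. The condition on \<open>first\<close> excludes the empty batches after the last task, when
  \<open>T'\<close> may still have later tasks.\<close>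

lemma same_state:
  assumes "first p T k < length T" "strt p T k < t"
  shows "first p T' k = first p T k \<and> stop p T' k = stop p T k"
  using assms
proof (induction k)
  case (Suc k)
  have k: "first p T k < length T" using Suc.prems(1) first_mono[of k "Suc k"] by simp
  have e: "stop p T (Suc k) < t" using stop_le_strt[of "Suc k"] Suc.prems(2) by linarith
  then have s: "strt p T k < t" "strt p T k + plen p T k < t"
    using strt_le_stop[of k] mem.slen_nonneg[of k] by (auto simp: stop_Suc)
  then have eq: "first p T' k = first p T k" "stop p T' k = stop p T k"
    using Suc.IH k by auto
  show ?case
    using same_members[OF k s(1) eq] same_batch(2)[OF k s(1) eq s(2)] by (simp add: stop_Suc)
qed simp

text \<open>The end of a parallel job depends on its hidden parallel work, so it is compared only if
  the run on \<open>T'\<close> completes it before \<open>t\<close>.\<close>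

lemma same_run:
  assumes i: "i < length T" and lt: "from_time p T i < t"
  shows "i < length T'" "parallel p T' i = parallel p T i" "from_time p T' i = from_time p T i"
    "rate p T' i = rate p T i" "to_time p T' i < t \<or> \<not> parallel p T i \<Longrightarrow> to_time p T' i = to_time p T i"
proof -
  define k where "k = batch_of p T i"
  have ik: "i \<in> members p T k" using batch_of[OF i] by (simp add: k_def)
  have k: "first p T k < length T" using ik i by (auto simp: members_def)
  have s: "strt p T k < t" using interval(1)[OF ik] lt by linarith
  have eq: "first p T' k = first p T k" "stop p T' k = stop p T k"
    using same_state[OF k s] by auto
  note m = same_members[OF k s eq] and b = same_batch[OF k s eq]
  have bo: "batch_of p T i = k" "batch_of p T' i = k"
    using batch_of_eq[OF ik] other.batch_of_eq[of i k] m(2) ik by auto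
  show i': "i < length T'" using same_task(1)[OF i] members_arr(2)[OF ik] s by simp
  have ser: "ser (T' ! i) = ser (T ! i)" using same_task(3)[OF i] members_arr(2)[OF ik] s by simp
  have *: "parallel p T' i = parallel p T i \<and> from_time p T' i = from_time p T i \<and>
    rate p T' i = rate p T i \<and> (\<not> parallel p T i \<longrightarrow> to_time p T' i = to_time p T i)"
  proof (cases "parallel p T i")
    case True
    then show ?thesis using b(1)[of i] lt m(1)
      by (simp add: parallel_def from_time_def rate_def bo)
  next
    case False
    then have "strt p T k + plen p T k < t" using lt by (simp add: from_time_def bo)
    then show ?thesis using b(2) False m(1) ser
      by (simp add: parallel_def from_time_def to_time_def rate_def bo)
  qed
  then show "parallel p T' i = parallel p T i" "from_time p T' i = from_time p T i"
    "rate p T' i = rate p T i" by auto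
  show "to_time p T' i = to_time p T i" if "to_time p T' i < t \<or> \<not> parallel p T i"
    using that * same_completion'[OF i'] by blast
qed

lemma same_alloc:
  assumes nz: "snd (batching p T) i s \<noteq> 0" and s: "s < t"
  shows "snd (batching p T') i s = snd (batching p T) i s"
proof -
  have i: "i < length T" "from_time p T i \<le> s" "s < to_time p T i"
    using nz by (auto simp: batching_def split: if_splits)
  then have "from_time p T i < t" using s by linarith
  note r = same_run[OF i(1) this]
  \<comment> \<open>Otherwise the job would complete on \<open>T'\<close> before \<open>t\<close>,
    hence at the same time on \<open>T\<close>, where it still runs at \<open>s\<close>.\<close>
  have "s < to_time p T' i"
  proof (rule ccontr)
    assume "\<not> s < to_time p T' i"
    then show False using r(5) i s by auto
  qed
  then show ?thesis using r i by (simp add: batching_def)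
qed

end

lemma same_info_sym: "same_info S T T' t \<Longrightarrow> same_info S T' T t"
  unfolding same_info_def by (elim conjE, intro conjI) (assumption | metis)+

lemma online_batching:
  assumes p: "1 \<le> p"
  shows "online_oblivious p (batching p)"
  unfolding online_oblivious_def
proof (intro allI impI conjI)
  fix T T' t
  assume "wf_tap p T" "wf_tap p T'" and info: "same_info (batching p) T T' t"
  then interpret A: indistinguishable p T T' t
    using p by unfold_locales
  interpret B: indistinguishable p T' T t
    using same_info_sym[OF info] by unfold_locales
  \<comment> \<open>A nonzero allocation on either side carries over to the other; the remaining
    case is zero on both.\<close>
  show "snd (batching p T) i s = snd (batching p T') i s" if "s < t" for i s
    using A.same_alloc[OF _ that, of i] B.same_alloc[OF _ that, of i] by metis
  show "fst (batching p T) i = fst (batching p T') i"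
    if "i < length T \<and> start (batching p T) i < t" for i
    using A.same_run(2)[of i] A.run(3)[of i] that by (simp add: batching_def)
qed

theorem theorem5p1:
  shows "\<exists>p0::nat. \<forall>p\<ge>p0. \<exists>S :: task list \<Rightarrow> schedule.
           (\<forall>T. wf_tap p T \<longrightarrow> valid p T (S T))
         \<and> online_oblivious p S
         \<and> (\<forall>T X. wf_tap p T \<longrightarrow> valid p T X \<longrightarrow> awake T (S T) \<le> 6 * awake T X)"
proof (intro exI[of _ 1] allI impI)
  fix p :: nat assume p: "1 \<le> p"
  have "tap p T" if "wf_tap p T" for T
    using p that by unfold_locales
  then show "\<exists>S :: task list \<Rightarrow> schedule.
           (\<forall>T. wf_tap p T \<longrightarrow> valid p T (S T))
         \<and> online_oblivious p S
         \<and> (\<forall>T X. wf_tap p T \<longrightarrow> valid p T X \<longrightarrow> awake T (S T) \<le> 6 * awake T X)"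
    using tap.valid_batching tap.competitive online_batching[OF p] by blast
qed

end
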